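(* Let $A_1,\dots,A_n$ be bounded linear operators on a Hilbert space $H$ and let $m\in\{1,\dots,n\}$. Then $$\left|\sum_{k=1}^nk^{m-1}A_k-S_{m-1}(n)\cdot\frac1n\sum_{k=1}^nA_k\right|^2 \le\left[nS_{2m-2}(n)-S_{m-1}^2(n)\right]\left[\frac1n\sum_{k=1}^n|A_k|^2-\frac1{n^2}\left|\sum_{k=1}^nA_k\right|^2\right].$$
   Context: For $p\in\mathbb{R}$ and $n\in\mathbb{N}$, $S_p(n):=\sum_{k=1}^nk^p$. For a bounded operator $T$, $|T|=(T^*T)^{1/2}$, and $\le$ is the usual order on self-adjoint bounded operators. The operator $\sum_{k=1}^nk^{m-1}A_k$ is the (discrete) Mellin transform at $m$ of $(A_1,\dots,A_n)$. *)

theory Defs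
  imports "HOL-Analysis.Analysis"
begin

(* The scalar field of a Hilbert space: real or complex. The axioms make x + sconj x and
   x * sconj x real, so every scalar is a root of a real quadratic; hence these two are,
   up to isomorphism, the only models. *)
class real_or_complex = real_normed_field +
  fixes sconj :: "'a \<Rightarrow> 'a"
  assumes sconj_add: "sconj (x + y) = sconj x + sconj y"
    and sconj_mult: "sconj (x * y) = sconj x * sconj y"
    and sconj_scaleR: "sconj (r *\<^sub>R x) = r *\<^sub>R sconj x"
    and mult_sconj: "x * sconj x = (norm x)\<^sup>2 *\<^sub>R 1"

instantiation real :: real_or_complex
begin
definition sconj_real :: "real \<Rightarrow> real" where "sconj_real x = x"
instance by standard (simp_all add: sconj_real_def power2_eq_square)
end

instantiation complex :: real_or_complex
begin
definition sconj_complex :: "complex \<Rightarrow> complex" where "sconj_complex z = cnj z"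
instance
proof
  fix x :: complex
  show "x * sconj x = (norm x)\<^sup>2 *\<^sub>R 1"
    by (simp only: sconj_complex_def complex_norm_square [symmetric] scaleR_conv_of_real mult_1_right)
qed (simp_all add: sconj_complex_def)
end

(* The underlying real Banach space structure (norm, completeness, real scalar multiples) is that
   of the type class; the inner product is linear in its first argument. *)
locale hilbert_space =
  fixes smul :: "'k::real_or_complex \<Rightarrow> 'a::banach \<Rightarrow> 'a"
    and ip :: "'a \<Rightarrow> 'a \<Rightarrow> 'k"
  assumes smul_add_right: "smul c (x + y) = smul c x + smul c y"
    and smul_add_left: "smul (c + d) x = smul c x + smul d x"
    and smul_smul: "smul c (smul d x) = smul (c * d) x"
    and smul_of_real: "smul (of_real r) x = r *\<^sub>R x"
    and ip_add_left: "ip (x + y) z = ip x z + ip y z"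
    and ip_smul_left: "ip (smul c x) y = c * ip x y"
    and ip_commute: "ip y x = sconj (ip x y)"
    and ip_self: "ip x x = of_real ((norm x)\<^sup>2)"

lemma hilbert_space_real:
  "hilbert_space (scaleR :: real \<Rightarrow> 'a::{real_inner, banach} \<Rightarrow> 'a) inner"
  by standard
    (simp_all add: algebra_simps inner_commute sconj_real_def power2_norm_eq_inner)

lemma hilbert_space_complex: "hilbert_space ((*) :: complex \<Rightarrow> complex \<Rightarrow> complex) (\<lambda>x y. x * cnj y)"
proof
  fix x :: complex
  show "x * cnj x = of_real ((norm x)\<^sup>2)"
    by (rule complex_norm_square [symmetric])
qed (simp_all add: algebra_simps sconj_complex_def scaleR_conv_of_real)

(* Elements of the library type of bounded real-linear maps are bounded operators on H when
   they are also homogeneous over the scalar field of H. *)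
definition bounded_operator ::
    "('k::real_or_complex \<Rightarrow> 'a::banach \<Rightarrow> 'a) \<Rightarrow> ('a \<Rightarrow>\<^sub>L 'a) \<Rightarrow> bool" where
  "bounded_operator smul T \<longleftrightarrow> (\<forall>c x. T (smul c x) = smul c (T x))"

definition is_adjoint ::
    "('a::banach \<Rightarrow> 'a \<Rightarrow> 'k::real_or_complex) \<Rightarrow> ('a \<Rightarrow>\<^sub>L 'a) \<Rightarrow> ('a \<Rightarrow>\<^sub>L 'a) \<Rightarrow> bool" where
  "is_adjoint ip T S \<longleftrightarrow> (\<forall>x y. ip (T x) y = ip x (S y))"

definition op_adjoint ::
    "('a::banach \<Rightarrow> 'a \<Rightarrow> 'k::real_or_complex) \<Rightarrow> ('a \<Rightarrow>\<^sub>L 'a) \<Rightarrow> ('a \<Rightarrow>\<^sub>L 'a)" where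
  "op_adjoint ip T = (THE S. is_adjoint ip T S)"

definition self_adjoint ::
    "('a::banach \<Rightarrow> 'a \<Rightarrow> 'k::real_or_complex) \<Rightarrow> ('a \<Rightarrow>\<^sub>L 'a) \<Rightarrow> bool" where
  "self_adjoint ip T \<longleftrightarrow> is_adjoint ip T T"

(* Self-adjointness implies homogeneity over the scalar field. *)
definition positive_op ::
    "('a::banach \<Rightarrow> 'a \<Rightarrow> 'k::real_or_complex) \<Rightarrow> ('a \<Rightarrow>\<^sub>L 'a) \<Rightarrow> bool" where
  "positive_op ip T \<longleftrightarrow> self_adjoint ip T \<and> (\<forall>x. \<exists>r\<ge>0. ip (T x) x = of_real r)"

definition op_le ::
    "('a::banach \<Rightarrow> 'a \<Rightarrow> 'k::real_or_complex) \<Rightarrow> ('a \<Rightarrow>\<^sub>L 'a) \<Rightarrow> ('a \<Rightarrow>\<^sub>L 'a) \<Rightarrow> bool" where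
  "op_le ip S T \<longleftrightarrow> self_adjoint ip S \<and> self_adjoint ip T \<and> positive_op ip (T - S)"

definition op_square :: "('a::real_normed_vector \<Rightarrow>\<^sub>L 'a) \<Rightarrow> ('a \<Rightarrow>\<^sub>L 'a)" where
  "op_square T = T o\<^sub>L T"

(* The positive square root of a positive operator exists and is unique. *)
definition op_sqrt ::
    "('a::banach \<Rightarrow> 'a \<Rightarrow> 'k::real_or_complex) \<Rightarrow> ('a \<Rightarrow>\<^sub>L 'a) \<Rightarrow> ('a \<Rightarrow>\<^sub>L 'a)" where
  "op_sqrt ip T = (SOME R. positive_op ip R \<and> op_square R = T)"

definition op_abs ::
    "('a::banach \<Rightarrow> 'a \<Rightarrow> 'k::real_or_complex) \<Rightarrow> ('a \<Rightarrow>\<^sub>L 'a) \<Rightarrow> ('a \<Rightarrow>\<^sub>L 'a)" where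
  "op_abs ip T = op_sqrt ip (op_adjoint ip T o\<^sub>L T)"

definition power_sum :: "real \<Rightarrow> nat \<Rightarrow> real" where
  "power_sum p n = (\<Sum>k=1..n. real k powr p)"

definition mellin_transform ::
    "nat \<Rightarrow> (nat \<Rightarrow> 'a::real_normed_vector \<Rightarrow>\<^sub>L 'a) \<Rightarrow> nat \<Rightarrow> ('a \<Rightarrow>\<^sub>L 'a)" where
  "mellin_transform n A m = (\<Sum>k=1..n. (real k powr (real m - 1)) *\<^sub>R A k)"

end

theory Submission
  imports Defs
begin

text \<open>In terms of quadratic forms, \<open>\<bar>T\<bar>\<^sup>2 = T\<^sup>* T\<close> turns \<open>\<langle>\<bar>T\<bar>\<^sup>2 x, x\<rangle>\<close> into \<open>\<parallel>T x\<parallel>\<^sup>2\<close>. With \<open>a k = A k x\<close> and the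
  weights \<open>w k = k powr (m - 1)\<close>, the operator inequality therefore says that, for every vector \<open>x\<close>, the squared norm of the
  covariance of \<open>w\<close> and \<open>a\<close> is at most the product of their variances. This is the Cauchy-Schwarz
  inequality after subtracting the means (\<open>norm_covariance_square_le\<close>); the particular weights enter
  only through \<open>(w k)\<^sup>2 = k powr (2 * m - 2)\<close>.

  The remaining work is to justify \<open>\<bar>T\<bar>\<^sup>2 = T\<^sup>* T\<close> (\<open>op_square_op_abs\<close>), since adjoint and square root are
  given by description operators and their existence has to be established. Adjoints come from
  the Riesz representation theorem (\<open>riesz_representation\<close>, \<open>adjoint_exists\<close>). The square root of
  \<open>T\<^sup>* T\<close> is obtained by scaling into the unit ball around the identity and solving
  \<open>Y = (B + Y\<^sup>2) / 2\<close> by a norm-convergent iteration (\<open>positive_sqrt_exists_near_id\<close>).\<close>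

context hilbert_space
begin

section \<open>The real inner product\<close>

lemma sconj_of_real: "sconj (of_real r) = (of_real r :: 'k)"
proof -
  have "sconj 1 = (1 :: 'k)"
    using mult_sconj[of "1 :: 'k"] by simp
  then show ?thesis
    by (simp add: of_real_def sconj_scaleR)
qed

lemma ip_add_right: "ip x (y + z) = ip x y + ip x z"
  by (metis ip_add_left ip_commute sconj_add)

lemma ip_smul_right: "ip x (smul c y) = sconj c * ip x y"
  by (metis ip_commute ip_smul_left sconj_mult)

lemma ip_scaleR_left: "ip (r *\<^sub>R x) y = of_real r * ip x y"
  by (metis smul_of_real ip_smul_left)

lemma ip_scaleR_right: "ip x (r *\<^sub>R y) = of_real r * ip x y"
  by (metis smul_of_real ip_smul_right sconj_of_real)

lemma ip_diff_left: "ip (x - y) z = ip x z - ip y z"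
  using ip_add_left[of "x - y" y z] by simp

lemma ip_diff_right: "ip x (y - z) = ip x y - ip x z"
  using ip_add_right[of x "y - z" z] by simp

lemma norm_smul: "norm (smul c x) = norm c * norm x"
proof -
  have "of_real ((norm (smul c x))\<^sup>2) = (c * sconj c) * ip x x"
    unfolding ip_self[symmetric] by (simp add: ip_smul_left ip_smul_right)
  also have "\<dots> = (of_real ((norm c * norm x)\<^sup>2) :: 'k)"
    by (simp add: mult_sconj ip_self scaleR_conv_of_real power_mult_distrib)
  finally have "(norm (smul c x))\<^sup>2 = (norm c * norm x)\<^sup>2"
    using of_real_eq_iff by blast
  then show ?thesis
    by (simp add: power2_eq_iff_nonneg)
qed

text \<open>The scalar field is only known through its axioms, so the real part of the inner product is
  introduced by polarisation instead of by a real-part function on scalars.\<close>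

definition rip :: "'a \<Rightarrow> 'a \<Rightarrow> real" where
  "rip x y = ((norm (x + y))\<^sup>2 - (norm x)\<^sup>2 - (norm y)\<^sup>2) / 2"

lemma of_real_rip: "of_real (2 * rip x y) = ip x y + ip y x"
proof -
  have "of_real (2 * rip x y) = ip (x + y) (x + y) - ip x x - ip y y"
    by (simp add: rip_def ip_self)
  also have "\<dots> = ip x y + ip y x"
    by (simp add: ip_add_left ip_add_right)
  finally show ?thesis .
qed

lemma rip_commute: "rip x y = rip y x"
  by (simp add: rip_def add.commute)

lemma rip_add_left: "rip (x + y) z = rip x z + rip y z"
proof -
  have "of_real (2 * rip (x + y) z) = (of_real (2 * rip x z + 2 * rip y z) :: 'k)"
    unfolding of_real_add of_real_rip by (simp add: ip_add_left ip_add_right)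
  then show ?thesis
    unfolding of_real_eq_iff by simp
qed

lemma rip_scaleR_left: "rip (r *\<^sub>R x) y = r * rip x y"
proof -
  have "of_real (2 * rip (r *\<^sub>R x) y) = (of_real (r * (2 * rip x y)) :: 'k)"
    unfolding of_real_mult[of r] of_real_rip
    by (simp add: ip_scaleR_left ip_scaleR_right distrib_left)
  then show ?thesis
    unfolding of_real_eq_iff by simp
qed

lemma rip_add_right: "rip x (y + z) = rip x y + rip x z"
  by (metis rip_commute rip_add_left)

lemma rip_scaleR_right: "rip x (r *\<^sub>R y) = r * rip x y"
  by (metis rip_commute rip_scaleR_left)

lemma rip_self: "rip x x = (norm x)\<^sup>2"
proof -
  have "norm (x + x) = 2 * norm x"
    by (metis norm_scaleR abs_numeral scaleR_2)
  then show ?thesis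
    by (simp add: rip_def power_mult_distrib)
qed

lemma norm_add_square: "(norm (x + y))\<^sup>2 = (norm x)\<^sup>2 + 2 * rip x y + (norm y)\<^sup>2"
  by (simp add: rip_def field_simps)

lemma rip_minus_right: "rip x (- y) = - rip x y"
  using rip_scaleR_right[of x "-1" y] by simp

lemma norm_diff_square: "(norm (x - y))\<^sup>2 = (norm x)\<^sup>2 - 2 * rip x y + (norm y)\<^sup>2"
  using norm_add_square[of x "- y"] by (simp add: rip_minus_right)

lemma rip_le: "rip x y \<le> norm x * norm y"
proof -
  have "(norm (x + y))\<^sup>2 \<le> (norm x + norm y)\<^sup>2"
    by (intro power_mono norm_triangle_ineq) simp
  then show ?thesis
    unfolding rip_def by (simp add: power2_sum)
qed

lemma rip_eq_ip: "ip x y = ip y x \<Longrightarrow> ip x y = of_real (rip x y)"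
  using of_real_rip[of x y] by simp

text \<open>Multiplying \<open>x\<close> by the conjugate of \<open>\<langle>x, y\<rangle>\<close> makes the inner product real, which reduces the
  inequality to the one for the real part.\<close>

lemma norm_ip_le: "norm (ip x y) \<le> norm x * norm y"
proof (cases "ip x y = 0")
  case False
  define z where "z = ip x y"
  have z: "z * sconj z = of_real ((norm z)\<^sup>2)"
    by (simp add: mult_sconj scaleR_conv_of_real)
  have "norm z * norm (sconj z) = (norm z)\<^sup>2"
    unfolding norm_mult[symmetric] z norm_of_real by simp
  with False have nz: "norm (sconj z) = norm z"
    by (simp add: z_def power2_eq_square)
  have ez: "ip (smul (sconj z) x) y = of_real ((norm z)\<^sup>2)"
    unfolding z[symmetric] by (simp add: ip_smul_left z_def mult.commute)
  have ez': "ip y (smul (sconj z) x) = ip (smul (sconj z) x) y"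
    by (metis ez ip_commute sconj_of_real)
  have "of_real ((norm z)\<^sup>2) = (of_real (rip (smul (sconj z) x) y) :: 'k)"
    using rip_eq_ip[OF ez'[symmetric]] ez by simp
  then have "(norm z)\<^sup>2 = rip (smul (sconj z) x) y"
    using of_real_eq_iff by blast
  also have "\<dots> \<le> norm z * (norm x * norm y)"
    using rip_le[of "smul (sconj z) x" y] by (simp add: norm_smul nz mult.assoc)
  finally show ?thesis
    using False by (simp add: z_def power2_eq_square)
qed simp

lemma bounded_linear_ip_left: "bounded_linear (\<lambda>x. ip x y)"
  by (rule bounded_linear_intro[where K = "norm y"])
    (simp_all add: ip_add_left ip_scaleR_left scaleR_conv_of_real norm_ip_le)

lemma bounded_linear_ip_right: "bounded_linear (ip x)"
  by (rule bounded_linear_intro[where K = "norm x"])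
    (simp_all add: ip_add_right ip_scaleR_right scaleR_conv_of_real norm_ip_le mult.commute[of _ "norm x"])

section \<open>Riesz representation and adjoints\<close>

text \<open>The representing vector is the minimiser of \<open>J x = \<parallel>x\<parallel>\<^sup>2 - 2 f x\<close>: by the parallelogram law
  minimising sequences of this functional are Cauchy, and the first-order condition at
  the minimiser is the representation.\<close>

lemma riesz_representation:
  fixes f :: "'a \<Rightarrow> real"
  assumes "bounded_linear f"
  shows "\<exists>z. \<forall>x. f x = rip x z"
proof -
  interpret f: bounded_linear f by fact
  define J where "J x = (norm x)\<^sup>2 - 2 * f x" for x
  obtain K where K: "\<And>x. norm (f x) \<le> norm x * K"
    using f.bounded by blast
  have "- K\<^sup>2 \<le> J x" for x
  proof -
    have "f x \<le> norm x * K"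
      using K[of x] by simp
    moreover have "0 \<le> (norm x - K)\<^sup>2"
      by simp
    ultimately show ?thesis
      by (simp add: J_def power2_diff)
  qed
  then have bdd: "bdd_below (range J)"
    by (intro bdd_belowI2)
  define d where "d = Inf (range J)"
  have d: "d \<le> J x" for x
    unfolding d_def by (rule cInf_lower) (use bdd in auto)
  have "\<exists>x. J x < d + 1 / real (Suc i)" for i
    using cInf_lessD[of "range J" "d + 1 / real (Suc i)"] unfolding d_def by auto
  then obtain x where x: "\<And>i. J (x i) < d + 1 / real (Suc i)"
    by metis
  have dist: "(norm (a - b))\<^sup>2 \<le> 2 * (J a - d) + 2 * (J b - d)" for a b
  proof -
    have "J ((1/2) *\<^sub>R (a + b)) = (norm (a + b))\<^sup>2 / 4 - (f a + f b)"
      by (simp add: J_def f.scaleR f.add power_mult_distrib power2_eq_square add_divide_distrib)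
    moreover have "(norm (a - b))\<^sup>2 = 2 * (norm a)\<^sup>2 + 2 * (norm b)\<^sup>2 - (norm (a + b))\<^sup>2"
      by (simp add: norm_add_square norm_diff_square)
    ultimately have "(norm (a - b))\<^sup>2 = 2 * J a + 2 * J b - 4 * J ((1/2) *\<^sub>R (a + b))"
      by (simp add: J_def[of a] J_def[of b])
    with d[of "(1/2) *\<^sub>R (a + b)"] show ?thesis
      by simp
  qed
  have "Cauchy x"
  proof (rule CauchyI)
    fix e :: real
    assume e: "0 < e"
    obtain N where N: "inverse (real (Suc N)) < e\<^sup>2 / 4"
      using reals_Archimedean[of "e\<^sup>2 / 4"] e by auto
    have "norm (x i - x j) < e" if "N \<le> i" "N \<le> j" for i j
    proof -
      have *: "J (x l) - d < e\<^sup>2 / 4" if "N \<le> l" for l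
      proof -
        have "1 / real (Suc l) \<le> inverse (real (Suc N))"
          using that by (simp add: field_simps)
        with x[of l] N show ?thesis
          by linarith
      qed
      have "(norm (x i - x j))\<^sup>2 \<le> 2 * (J (x i) - d) + 2 * (J (x j) - d)"
        by (rule dist)
      also have "\<dots> < 2 * (e\<^sup>2 / 4) + 2 * (e\<^sup>2 / 4)"
        using *[OF that(1)] *[OF that(2)] by (intro add_strict_mono mult_strict_left_mono) auto
      finally have "(norm (x i - x j))\<^sup>2 < e\<^sup>2"
        by simp
      then show ?thesis
        using e by (simp add: power_less_imp_less_base)
    qed
    then show "\<exists>M. \<forall>m\<ge>M. \<forall>n\<ge>M. norm (x m - x n) < e"
      by blast
  qed
  then obtain z where z: "x \<longlonglongrightarrow> z"
    by (auto simp: Cauchy_convergent_iff convergent_def)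
  have "(\<lambda>i. J (x i)) \<longlonglongrightarrow> J z"
    unfolding J_def by (intro tendsto_intros f.tendsto z)
  moreover have "(\<lambda>i. d + 1 / real (Suc i)) \<longlonglongrightarrow> d + 0"
    by (intro tendsto_add tendsto_const lim_1_over_n[THEN LIMSEQ_Suc])
  ultimately have Jz: "J z \<le> d"
    using x by (intro LIMSEQ_le[of "\<lambda>i. J (x i)" "J z" "\<lambda>i. d + 1 / real (Suc i)"]) (auto intro: less_imp_le)
  have "f x = rip x z" for x
  proof (rule ccontr)
    define a where "a = rip z x - f x"
    define q where "q = (norm x)\<^sup>2"
    \<comment> \<open>The minimiser of \<open>2 t a + t\<^sup>2 q\<close> is \<open>- a / q\<close>; the shift of the denominator also covers \<open>q = 0\<close>.\<close>
    define t where "t = - a / (q + 1)"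
    assume "f x \<noteq> rip x z"
    then have a: "a \<noteq> 0"
      by (simp add: a_def rip_commute)
    have q: "0 \<le> q"
      by (simp add: q_def)
    have "0 \<le> J (z + t *\<^sub>R x) - J z"
      using d[of "z + t *\<^sub>R x"] Jz by simp
    also have "\<dots> = 2 * t * a + t\<^sup>2 * q"
      by (simp add: J_def norm_add_square f.add f.scaleR rip_scaleR_right a_def q_def
          power_mult_distrib algebra_simps)
    also have "\<dots> = - (a\<^sup>2 * (q + 2)) / (q + 1)\<^sup>2"
      using q by (simp add: t_def divide_simps power2_eq_square) (auto simp: algebra_simps)
    also have "\<dots> < 0"
      using a q by (simp add: divide_neg_pos)
    finally show False
      by simp
  qed
  then show ?thesis
    by blast
qed

lemma ip_right_eqI:
  assumes "\<And>x. ip x y = ip x z"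
  shows "y = z"
proof -
  have "of_real ((norm (y - z))\<^sup>2) = (0 :: 'k)"
    using assms[of "y - z"] by (simp only: ip_self[symmetric] ip_diff_right) simp
  then show ?thesis
    by simp
qed

text \<open>Riesz representation gives a map that is adjoint for the real inner product. Homogeneity of
  \<open>T\<close> lifts this to \<open>ip\<close>: the difference of the two sides of the adjoint equation
  has vanishing real part and is homogeneous in \<open>x\<close>, and scaling \<open>x\<close> by the conjugate of this difference
  replaces it by its squared norm, which must then be 0.\<close>

lemma adjoint_exists:
  assumes T: "bounded_operator smul T"
  shows "\<exists>S. is_adjoint ip T S"
proof -
  have "\<exists>z. \<forall>x. rip (T x) y = rip x z" for y
  proof (rule riesz_representation)
    have rip_ge: "- rip x y \<le> norm x * norm y" for x
      using rip_le[of x "- y"] by (simp add: rip_minus_right)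
    have "bounded_linear (\<lambda>x. rip x y)"
      by (rule bounded_linear_intro[where K = "norm y"])
        (simp_all add: rip_add_left rip_scaleR_left abs_le_iff rip_le rip_ge)
    from bounded_linear_compose[OF this blinfun.bounded_linear_right[of T]]
    show "bounded_linear (\<lambda>x. rip (T x) y)" .
  qed
  then obtain S where S: "\<And>x y. rip (T x) y = rip x (S y)"
    by metis
  have adj: "ip (T x) y = ip x (S y)" for x y
  proof -
    define \<delta> where "\<delta> = ip (T x) y - ip x (S y)"
    define c where "c = sconj \<delta>"
    have "ip (smul c (T x)) y + ip y (smul c (T x)) = ip (smul c x) (S y) + ip (S y) (smul c x)"
      using S[of "smul c x" y] T unfolding bounded_operator_def of_real_rip[symmetric] by simp
    moreover have "ip (smul c (T x)) y - ip (smul c x) (S y) = of_real ((norm \<delta>)\<^sup>2)"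
      using mult_sconj[of \<delta>]
      by (simp add: ip_smul_left \<delta>_def c_def scaleR_conv_of_real algebra_simps)
    moreover from this have "ip y (smul c (T x)) - ip (S y) (smul c x) = of_real ((norm \<delta>)\<^sup>2)"
      by (metis add_diff_cancel_right' diff_add_cancel ip_commute sconj_add sconj_of_real)
    ultimately have "of_real ((norm \<delta>)\<^sup>2) + of_real ((norm \<delta>)\<^sup>2) = (0 :: 'k)"
      by (simp add: algebra_simps)
    then have "of_real (2 * (norm \<delta>)\<^sup>2) = (0 :: 'k)"
      by simp
    then show ?thesis
      by (simp only: of_real_eq_0_iff) (simp add: \<delta>_def)
  qed
  have "bounded_linear S"
  proof (rule bounded_linear_intro)
    show "S (x + y) = S x + S y" for x y
      by (rule ip_right_eqI) (simp only: adj[symmetric] ip_add_right)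
    show "S (r *\<^sub>R x) = r *\<^sub>R S x" for r x
      by (rule ip_right_eqI) (simp only: adj[symmetric] ip_scaleR_right)
    show "norm (S x) \<le> norm x * norm T" for x
    proof (cases "S x = 0")
      case False
      have "(norm (S x))\<^sup>2 = rip (T (S x)) x"
        by (simp add: S rip_self)
      also have "\<dots> \<le> norm (T (S x)) * norm x"
        by (rule rip_le)
      also have "\<dots> \<le> norm T * norm (S x) * norm x"
        by (intro mult_right_mono norm_blinfun) simp
      finally show ?thesis
        using False by (simp add: power2_eq_square algebra_simps)
    qed simp
  qed
  then have "is_adjoint ip T (Blinfun S)"
    by (simp add: is_adjoint_def adj bounded_linear_Blinfun_apply)
  then show ?thesis
    by blast
qed

lemma is_adjoint_op_adjoint:
  assumes "bounded_operator smul T"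
  shows "is_adjoint ip T (op_adjoint ip T)"
proof -
  obtain S where S: "is_adjoint ip T S"
    using adjoint_exists[OF assms] by blast
  moreover have "S' = S" if "is_adjoint ip T S'" for S'
    using S that by (intro blinfun_eqI ip_right_eqI) (metis is_adjoint_def)
  ultimately show ?thesis
    unfolding op_adjoint_def by (rule theI)
qed

section \<open>Self-adjoint operators and square roots\<close>

lemma self_adjoint_id: "self_adjoint ip id_blinfun"
  by (simp add: self_adjoint_def is_adjoint_def)

lemma self_adjoint_0: "self_adjoint ip 0"
  using ip_scaleR_left[of 0] ip_scaleR_right[of _ 0]
  by (simp add: self_adjoint_def is_adjoint_def)

lemma self_adjoint_add:
  "self_adjoint ip S \<Longrightarrow> self_adjoint ip T \<Longrightarrow> self_adjoint ip (S + T)"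
  by (simp add: self_adjoint_def is_adjoint_def blinfun.add_left ip_add_left ip_add_right)

lemma self_adjoint_diff:
  "self_adjoint ip S \<Longrightarrow> self_adjoint ip T \<Longrightarrow> self_adjoint ip (S - T)"
  by (simp add: self_adjoint_def is_adjoint_def blinfun.diff_left ip_diff_left ip_diff_right)

lemma self_adjoint_scaleR:
  "self_adjoint ip T \<Longrightarrow> self_adjoint ip (r *\<^sub>R T)"
  by (simp add: self_adjoint_def is_adjoint_def blinfun.scaleR_left ip_scaleR_left ip_scaleR_right)

lemma self_adjoint_sum:
  "(\<And>k. k \<in> I \<Longrightarrow> self_adjoint ip (T k)) \<Longrightarrow> self_adjoint ip (\<Sum>k\<in>I. T k)"
  by (induction I rule: infinite_finite_induct) (auto simp: self_adjoint_0 intro: self_adjoint_add)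

lemma self_adjoint_op_square:
  "self_adjoint ip T \<Longrightarrow> self_adjoint ip (op_square T)"
  by (simp add: self_adjoint_def is_adjoint_def op_square_def)

lemma self_adjoint_limit:
  assumes "\<And>i. self_adjoint ip (Y i)" and "Y \<longlonglongrightarrow> T"
  shows "self_adjoint ip T"
proof -
  have lim: "(\<lambda>i. Y i x) \<longlonglongrightarrow> T x" for x
    using assms(2) by (intro tendsto_intros)
  have "ip (T x) y = ip x (T y)" for x y
  proof (rule LIMSEQ_unique)
    show "(\<lambda>i. ip (Y i x) y) \<longlonglongrightarrow> ip (T x) y"
      by (rule bounded_linear.tendsto[OF bounded_linear_ip_left lim])
    show "(\<lambda>i. ip (Y i x) y) \<longlonglongrightarrow> ip x (T y)"
      using bounded_linear.tendsto[OF bounded_linear_ip_right lim, of x y] assms(1)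
      by (simp add: self_adjoint_def is_adjoint_def)
  qed
  then show ?thesis
    by (simp add: self_adjoint_def is_adjoint_def)
qed

lemma self_adjoint_ip_eq_rip:
  assumes "self_adjoint ip T"
  shows "ip (T x) x = of_real (rip (T x) x)"
  by (rule rip_eq_ip) (use assms in \<open>simp add: self_adjoint_def is_adjoint_def\<close>)

lemma positive_op_iff: "positive_op ip T \<longleftrightarrow> self_adjoint ip T \<and> (\<forall>x. 0 \<le> rip (T x) x)"
proof (cases "self_adjoint ip T")
  case True
  then show ?thesis
    by (auto simp: positive_op_def self_adjoint_ip_eq_rip[OF True])
qed (simp add: positive_op_def)

text \<open>Writing \<open>T = 1 - B\<close>, the operator \<open>1 - Y\<close> squares to \<open>T\<close> iff \<open>Y = (B + Y\<^sup>2) / 2\<close>. The fixed-point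
  iteration for this equation is dominated term by term by the scalar iteration
  \<open>y \<mapsto> (1 + y\<^sup>2) / 2\<close> started at 0, which increases and stays below 1. So the operator iterates
  converge in norm, and their limit is a contraction, which makes \<open>1 - Y\<close> positive.\<close>

lemma positive_sqrt_exists_near_id:
  assumes T: "self_adjoint ip T" and contr: "norm (id_blinfun - T) \<le> 1"
  shows "\<exists>R. positive_op ip R \<and> op_square R = T"
proof -
  define B where "B = id_blinfun - T"
  define Y :: "nat \<Rightarrow> 'a \<Rightarrow>\<^sub>L 'a" where
    "Y = rec_nat 0 (\<lambda>_ Z. (1/2) *\<^sub>R (B + op_square Z))"
  define y :: "nat \<Rightarrow> real" where "y = rec_nat 0 (\<lambda>_ z. (1 + z\<^sup>2) / 2)"
  have Y0: "Y 0 = 0" and YS: "\<And>i. Y (Suc i) = (1/2) *\<^sub>R (B + op_square (Y i))"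
    by (simp_all add: Y_def)
  have y0: "y 0 = 0" and yS: "\<And>i. y (Suc i) = (1 + (y i)\<^sup>2) / 2"
    by (simp_all add: y_def)
  have y_bounds: "0 \<le> y i \<and> y i \<le> 1" for i
    by (induction i) (auto simp: y0 yS power_le_one)
  have y_mono: "incseq y"
  proof (rule incseq_SucI)
    fix i
    have "0 \<le> (1 - y i)\<^sup>2"
      by simp
    then show "y i \<le> y (Suc i)"
      by (simp add: yS power2_diff)
  qed
  have norm_Y: "norm (Y i) \<le> y i" for i
  proof (induction i)
    case (Suc i)
    have "norm (op_square (Y i)) \<le> norm (Y i) * norm (Y i)"
      unfolding op_square_def by (rule norm_blinfun_compose)
    also have "\<dots> \<le> (y i)\<^sup>2"
      unfolding power2_eq_square using Suc by (intro mult_mono) (auto simp: y_bounds)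
    finally have "norm (B + op_square (Y i)) \<le> 1 + (y i)\<^sup>2"
      using contr norm_triangle_ineq[of B "op_square (Y i)"] by (simp add: B_def)
    then show ?case
      by (simp add: YS yS)
  qed (simp add: Y0 y0)
  have dominated: "norm (Y (i + l) - Y i) \<le> y (i + l) - y i" for i l
  proof (induction i)
    case 0
    show ?case
      using norm_Y[of l] by (simp add: Y0 y0)
  next
    case (Suc i)
    let ?D = "Y (i + l) - Y i"
    have "op_square (Y (i + l)) - op_square (Y i) = (Y (i + l) o\<^sub>L ?D) + (?D o\<^sub>L Y i)"
      by (rule blinfun_eqI) (simp add: op_square_def blinfun.diff_left blinfun.diff_right blinfun.add_left)
    also have "norm \<dots> \<le> norm (Y (i + l)) * norm ?D + norm ?D * norm (Y i)"
      by (intro norm_triangle_le add_mono norm_blinfun_compose)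
    also have "\<dots> \<le> y (i + l) * (y (i + l) - y i) + (y (i + l) - y i) * y i"
      using Suc norm_Y y_bounds incseqD[OF y_mono, of i "i + l"]
      by (intro add_mono mult_mono) auto
    also have "\<dots> = (y (i + l))\<^sup>2 - (y i)\<^sup>2"
      by (simp add: power2_eq_square algebra_simps)
    finally have "norm (op_square (Y (i + l)) - op_square (Y i)) \<le> (y (i + l))\<^sup>2 - (y i)\<^sup>2" .
    then have "norm (op_square (Y (i + l)) - op_square (Y i)) / 2 \<le> ((y (i + l))\<^sup>2 - (y i)\<^sup>2) / 2"
      by (rule divide_right_mono) simp
    moreover have "Y (Suc i + l) - Y (Suc i) = (1/2) *\<^sub>R (op_square (Y (i + l)) - op_square (Y i))"
      by (simp add: YS scaleR_right_diff_distrib[symmetric])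
    then have "norm (Y (Suc i + l) - Y (Suc i)) = norm (op_square (Y (i + l)) - op_square (Y i)) / 2"
      by simp
    moreover have "y (Suc i + l) - y (Suc i) = ((y (i + l))\<^sup>2 - (y i)\<^sup>2) / 2"
      by (simp add: yS diff_divide_distrib add_divide_distrib)
    ultimately show ?case
      by (simp only:)
  qed
  have "Cauchy y"
    using incseq_convergent[OF y_mono, of 1] y_bounds LIMSEQ_imp_Cauchy by metis
  have "Cauchy Y"
  proof (rule CauchyI')
    fix e :: real
    assume "0 < e"
    with \<open>Cauchy y\<close> obtain M where M: "\<And>i j. M \<le> i \<Longrightarrow> M \<le> j \<Longrightarrow> norm (y i - y j) < e"
      using CauchyD by blast
    have "dist (Y i) (Y j) < e" if "M \<le> i" "i < j" for i j
    proof -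
      have "norm (Y j - Y i) \<le> y j - y i"
        using dominated[of i "j - i"] that by simp
      also have "\<dots> < e"
        using M[of j i] that by simp
      finally show ?thesis
        by (simp add: dist_norm norm_minus_commute)
    qed
    then show "\<exists>M. \<forall>m\<ge>M. \<forall>n>m. dist (Y m) (Y n) < e"
      by blast
  qed
  then obtain Z where Z: "Y \<longlonglongrightarrow> Z"
    by (auto simp: Cauchy_convergent_iff convergent_def)
  have "self_adjoint ip B"
    unfolding B_def by (intro self_adjoint_diff self_adjoint_id T)
  then have "self_adjoint ip (Y i)" for i
    by (induction i)
      (auto simp: Y0 YS self_adjoint_0 intro!: self_adjoint_scaleR self_adjoint_add self_adjoint_op_square)
  then have Z_sa: "self_adjoint ip Z"
    using Z by (rule self_adjoint_limit)
  have "norm Z \<le> 1"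
    using tendsto_norm[OF Z] norm_Y y_bounds
    by (intro Lim_bounded[of "\<lambda>i. norm (Y i)" "norm Z" 0]) (auto intro: order_trans)
  have "(\<lambda>i. Y (Suc i)) \<longlonglongrightarrow> (1/2) *\<^sub>R (B + op_square Z)"
    unfolding YS op_square_def
    by (intro tendsto_intros Z bounded_bilinear.tendsto[OF bounded_bilinear_blinfun_compose])
  then have limit_eq: "Z = (1/2) *\<^sub>R (B + op_square Z)"
    using LIMSEQ_Suc[OF Z] LIMSEQ_unique by blast
  have "2 *\<^sub>R Z = B + op_square Z"
    by (subst limit_eq) simp
  then have "2 *\<^sub>R Z x = x - T x + Z (Z x)" for x
    by (metis B_def blinfun.add_left blinfun.diff_left blinfun.scaleR_left blinfun_apply_blinfun_compose
        blinfun_apply_id_blinfun id_apply op_square_def)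
  then have "op_square (id_blinfun - Z) = T"
    by (intro blinfun_eqI)
      (simp add: op_square_def blinfun.diff_left blinfun.diff_right scaleR_2 algebra_simps)
  moreover have "positive_op ip (id_blinfun - Z)"
    unfolding positive_op_iff
  proof (intro conjI allI)
    show "self_adjoint ip (id_blinfun - Z)"
      by (intro self_adjoint_diff self_adjoint_id Z_sa)
    fix x
    have "rip (Z x) x \<le> norm (Z x) * norm x"
      by (rule rip_le)
    also have "\<dots> \<le> (norm Z * norm x) * norm x"
      by (intro mult_right_mono norm_blinfun) simp
    also have "\<dots> \<le> (1 * norm x) * norm x"
      using \<open>norm Z \<le> 1\<close> by (intro mult_right_mono) auto
    finally have "rip (Z x) x \<le> (norm x)\<^sup>2"
      by (simp add: power2_eq_square)
    moreover have "rip (x - Z x) x + rip (Z x) x = rip x x"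
      using rip_add_left[of "x - Z x" "Z x" x] by simp
    ultimately show "0 \<le> rip ((id_blinfun - Z) x) x"
      by (simp add: blinfun.diff_left rip_self)
  qed
  ultimately show ?thesis
    by blast
qed

lemma rip_adjoint:
  assumes adj: "is_adjoint ip T S"
  shows "rip (S x) y = rip x (T y)"
proof -
  have "ip (S x) y = ip x (T y)"
    by (metis adj is_adjoint_def ip_commute)
  moreover have "ip y (S x) = ip (T y) x"
    using adj by (simp add: is_adjoint_def)
  ultimately have "of_real (2 * rip (S x) y) = (of_real (2 * rip x (T y)) :: 'k)"
    unfolding of_real_rip by simp
  then show ?thesis
    unfolding of_real_eq_iff by simp
qed

lemma self_adjoint_adjoint_compose:
  "is_adjoint ip T S \<Longrightarrow> self_adjoint ip (S o\<^sub>L T)"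
  unfolding self_adjoint_def is_adjoint_def by simp (metis ip_commute)

text \<open>For any positive \<open>c \<ge> \<parallel>S\<parallel>\<^sup>2\<close>, the operator \<open>Q = S T / c\<close> satisfies
  \<open>\<parallel>Q x\<parallel>\<^sup>2 \<le> \<langle>Q x, x\<rangle>\<close>, because \<open>\<langle>S T x, x\<rangle> = \<parallel>T x\<parallel>\<^sup>2\<close>. Expanding \<open>\<parallel>x - Q x\<parallel>\<^sup>2\<close> then shows that
  \<open>1 - Q\<close> is a contraction, so \<open>Q\<close> has a positive square root.\<close>

lemma adjoint_compose_has_positive_sqrt:
  assumes adj: "is_adjoint ip T S"
  shows "\<exists>R. positive_op ip R \<and> op_square R = S o\<^sub>L T"
proof -
  define c where "c = (norm S)\<^sup>2 + 1"
  define Q where "Q = (1 / c) *\<^sub>R (S o\<^sub>L T)"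
  have c: "0 < c"
    by (simp add: c_def add_nonneg_pos)
  have Q_sa: "self_adjoint ip Q"
    unfolding Q_def by (intro self_adjoint_scaleR self_adjoint_adjoint_compose adj)
  have "norm ((id_blinfun - Q) x) \<le> 1 * norm x" for x
  proof -
    have "norm (S (T x)) \<le> norm S * norm (T x)"
      by (rule norm_blinfun)
    then have "(norm (S (T x)))\<^sup>2 \<le> (norm S * norm (T x))\<^sup>2"
      by (intro power_mono) auto
    also have "\<dots> \<le> c * (norm (T x))\<^sup>2"
      unfolding power_mult_distrib c_def by (intro mult_right_mono) auto
    finally have "(norm (Q x))\<^sup>2 \<le> (norm (T x))\<^sup>2 / c"
      using c by (simp add: Q_def blinfun.scaleR_left power_divide field_simps power2_eq_square)
    also have "\<dots> = rip x (Q x)"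
      by (simp add: Q_def blinfun.scaleR_left rip_scaleR_right rip_commute[of x] rip_adjoint[OF adj] rip_self)
    finally have "(norm (x - Q x))\<^sup>2 \<le> (norm x)\<^sup>2"
      using zero_le_power2[of "norm (Q x)"] unfolding norm_diff_square by linarith
    then have "norm (x - Q x) \<le> norm x"
      by (rule power2_le_imp_le) simp
    then show ?thesis
      by (simp add: blinfun.diff_left)
  qed
  then have "norm (id_blinfun - Q) \<le> 1"
    by (intro norm_blinfun_bound) auto
  with Q_sa obtain R where R: "positive_op ip R" "op_square R = Q"
    using positive_sqrt_exists_near_id by blast
  have "positive_op ip (sqrt c *\<^sub>R R)"
    using R(1) c unfolding positive_op_iff
    by (auto intro: self_adjoint_scaleR simp: blinfun.scaleR_left rip_scaleR_left)
  moreover have "op_square (sqrt c *\<^sub>R R) = c *\<^sub>R op_square R"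
    using c by (intro blinfun_eqI)
      (simp add: op_square_def blinfun.scaleR_left blinfun.scaleR_right)
  moreover have "\<dots> = S o\<^sub>L T"
    using c by (simp add: R(2) Q_def)
  ultimately show ?thesis
    by auto
qed

lemma op_square_op_abs:
  assumes "bounded_operator smul T"
  shows "op_square (op_abs ip T) = op_adjoint ip T o\<^sub>L T"
  using someI_ex[OF adjoint_compose_has_positive_sqrt[OF is_adjoint_op_adjoint[OF assms]]]
  unfolding op_abs_def op_sqrt_def by simp

lemma self_adjoint_square_abs:
  "bounded_operator smul T \<Longrightarrow> self_adjoint ip (op_square (op_abs ip T))"
  by (simp add: op_square_op_abs is_adjoint_op_adjoint self_adjoint_adjoint_compose)

lemma rip_square_abs:
  "bounded_operator smul T \<Longrightarrow> rip (op_square (op_abs ip T) x) x = (norm (T x))\<^sup>2"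
  by (simp add: op_square_op_abs rip_adjoint[OF is_adjoint_op_adjoint] rip_self)

section \<open>The covariance inequality\<close>

lemma rip_diff_left: "rip (x - y) z = rip x z - rip y z"
  using rip_add_left[of "x - y" y z] by simp

lemma rip_sum_left: "rip (\<Sum>k\<in>I. f k) y = (\<Sum>k\<in>I. rip (f k) y)"
  using rip_scaleR_left[of 0 _ y]
  by (induction I rule: infinite_finite_induct) (simp_all add: rip_add_left)

lemma sum_norm_centred_square:
  fixes a :: "'i \<Rightarrow> 'a"
  assumes "finite I" and "I \<noteq> {}"
  defines "\<mu> \<equiv> (1 / real (card I)) *\<^sub>R (\<Sum>k\<in>I. a k)"
  shows "(\<Sum>k\<in>I. (norm (a k - \<mu>))\<^sup>2) = (\<Sum>k\<in>I. (norm (a k))\<^sup>2) - (norm (\<Sum>k\<in>I. a k))\<^sup>2 / real (card I)"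
proof -
  have n: "real (card I) > 0"
    using assms by (simp add: card_gt_0_iff)
  have "(\<Sum>k\<in>I. (norm (a k - \<mu>))\<^sup>2)
      = (\<Sum>k\<in>I. (norm (a k))\<^sup>2) - 2 * rip (\<Sum>k\<in>I. a k) \<mu> + real (card I) * (norm \<mu>)\<^sup>2"
    by (simp add: norm_diff_square sum.distrib sum_subtractf sum_distrib_left rip_sum_left)
  also have "rip (\<Sum>k\<in>I. a k) \<mu> = (norm (\<Sum>k\<in>I. a k))\<^sup>2 / real (card I)"
    by (simp add: \<mu>_def rip_scaleR_right rip_self)
  also have "real (card I) * (norm \<mu>)\<^sup>2 = (norm (\<Sum>k\<in>I. a k))\<^sup>2 / real (card I)"
    using n by (simp add: \<mu>_def power_divide power2_eq_square)
  finally show ?thesis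
    by simp
qed

end

lemma sum_centred_square:
  fixes w :: "'i \<Rightarrow> real"
  assumes "finite I" and "I \<noteq> {}"
  shows "(\<Sum>k\<in>I. (w k - (\<Sum>j\<in>I. w j) / real (card I))\<^sup>2)
    = (\<Sum>k\<in>I. (w k)\<^sup>2) - (\<Sum>k\<in>I. w k)\<^sup>2 / real (card I)"
proof -
  interpret R: hilbert_space "scaleR :: real \<Rightarrow> real \<Rightarrow> real" inner
    by (rule hilbert_space_real)
  show ?thesis
    using R.sum_norm_centred_square[OF assms, of w] by simp
qed

text \<open>The left-hand side is the covariance sum of \<open>w\<close> and \<open>a\<close>, so it equals the sum of the products of the centred
  terms. The triangle inequality and the Cauchy-Schwarz inequality bound it by the product of the two
  sums of squared deviations, in which a factor \<open>N\<close> has been moved from the second to the first.\<close>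

lemma (in hilbert_space) norm_covariance_square_le:
  fixes w :: "'i \<Rightarrow> real" and a :: "'i \<Rightarrow> 'a"
  assumes "finite I" and "I \<noteq> {}"
  defines "N \<equiv> real (card I)"
  shows "(norm ((\<Sum>k\<in>I. w k *\<^sub>R a k) - (\<Sum>k\<in>I. w k) *\<^sub>R ((1 / N) *\<^sub>R (\<Sum>k\<in>I. a k))))\<^sup>2
    \<le> (N * (\<Sum>k\<in>I. (w k)\<^sup>2) - (\<Sum>k\<in>I. w k)\<^sup>2)
      * ((1 / N) * (\<Sum>k\<in>I. (norm (a k))\<^sup>2) - (1 / N\<^sup>2) * (norm (\<Sum>k\<in>I. a k))\<^sup>2)"
    (is "(norm ?C)\<^sup>2 \<le> ?R")
proof -
  have N: "N > 0"
    using assms by (simp add: card_gt_0_iff)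
  define v where "v = (\<Sum>k\<in>I. w k) / N"
  define \<mu> where "\<mu> = (1 / N) *\<^sub>R (\<Sum>k\<in>I. a k)"
  have "(\<Sum>k\<in>I. (w k - v) *\<^sub>R (a k - \<mu>))
      = (\<Sum>k\<in>I. w k *\<^sub>R a k) - (\<Sum>k\<in>I. w k) *\<^sub>R \<mu> - v *\<^sub>R (\<Sum>k\<in>I. a k) + (N * v) *\<^sub>R \<mu>"
    by (simp add: algebra_simps sum.distrib sum_subtractf scaleR_sum_left scaleR_sum_right
        N_def sum_constant_scaleR)
  also have "v *\<^sub>R (\<Sum>k\<in>I. a k) = (N * v) *\<^sub>R \<mu>"
    using N by (simp add: \<mu>_def)
  finally have "norm ?C = norm (\<Sum>k\<in>I. (w k - v) *\<^sub>R (a k - \<mu>))"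
    by (simp add: \<mu>_def)
  also have "\<dots> \<le> (\<Sum>k\<in>I. \<bar>w k - v\<bar> * norm (a k - \<mu>))"
    using norm_sum[of "\<lambda>k. (w k - v) *\<^sub>R (a k - \<mu>)" I] by simp
  finally have "(norm ?C)\<^sup>2 \<le> (\<Sum>k\<in>I. \<bar>w k - v\<bar> * norm (a k - \<mu>))\<^sup>2"
    by (intro power_mono) auto
  also have "\<dots> \<le> (\<Sum>k\<in>I. \<bar>w k - v\<bar>\<^sup>2) * (\<Sum>k\<in>I. (norm (a k - \<mu>))\<^sup>2)"
    by (rule Cauchy_Schwarz_ineq_sum)
  also have "\<dots> = ((\<Sum>k\<in>I. (w k)\<^sup>2) - (\<Sum>k\<in>I. w k)\<^sup>2 / N)
      * ((\<Sum>k\<in>I. (norm (a k))\<^sup>2) - (norm (\<Sum>k\<in>I. a k))\<^sup>2 / N)"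
    using sum_centred_square[OF assms(1,2), of w] sum_norm_centred_square[OF assms(1,2), of a]
    by (simp add: v_def \<mu>_def N_def)
  also have "\<dots> = ?R"
    using N by (simp add: field_simps power2_eq_square)
  finally show ?thesis .
qed

theorem mainTheorem6:
  fixes smul :: "'k::real_or_complex \<Rightarrow> 'a::banach \<Rightarrow> 'a"
    and ip :: "'a \<Rightarrow> 'a \<Rightarrow> 'k"
    and A :: "nat \<Rightarrow> 'a \<Rightarrow>\<^sub>L 'a"
    and n m :: nat
  assumes "hilbert_space smul ip"
    and "\<And>k. k \<in> {1..n} \<Longrightarrow> bounded_operator smul (A k)"
    and "m \<in> {1..n}"
  shows "op_le ip
    (op_square (op_abs ip
      (mellin_transform n A m
        - power_sum (real m - 1) n *\<^sub>R ((1 / real n) *\<^sub>R (\<Sum>k=1..n. A k)))))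
    ((real n * power_sum (2 * real m - 2) n - (power_sum (real m - 1) n)\<^sup>2) *\<^sub>R
      ((1 / real n) *\<^sub>R (\<Sum>k=1..n. op_square (op_abs ip (A k)))
        - (1 / (real n)\<^sup>2) *\<^sub>R op_square (op_abs ip (\<Sum>k=1..n. A k))))"
proof -
  interpret hilbert_space smul ip by fact
  note A = assms(2)
  define w where "w k = real k powr (real m - 1)" for k
  define C where "C = mellin_transform n A m - power_sum (real m - 1) n *\<^sub>R ((1 / real n) *\<^sub>R (\<Sum>k=1..n. A k))"
  define V where "V = real n * power_sum (2 * real m - 2) n - (power_sum (real m - 1) n)\<^sup>2"
  define W where "W = (1 / real n) *\<^sub>R (\<Sum>k=1..n. op_square (op_abs ip (A k)))
        - (1 / (real n)\<^sup>2) *\<^sub>R op_square (op_abs ip (\<Sum>k=1..n. A k))"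
  have hom_sum: "bounded_operator smul (\<Sum>k=1..n. u k *\<^sub>R A k)" for u :: "nat \<Rightarrow> real"
    unfolding bounded_operator_def
  proof (intro allI)
    fix c x
    have hom: "A k (smul c x) = smul c (A k x)" if "k \<in> {1..n}" for k
      using A[OF that] by (simp add: bounded_operator_def)
    interpret c: additive "smul c"
      by unfold_locales (rule smul_add_right)
    have "smul c (r *\<^sub>R y) = r *\<^sub>R smul c y" for r y
      by (metis smul_of_real smul_smul mult.commute)
    then show "(\<Sum>k=1..n. u k *\<^sub>R A k) (smul c x) = smul c ((\<Sum>k=1..n. u k *\<^sub>R A k) x)"
      by (simp add: blinfun.sum_left blinfun.scaleR_left c.sum hom)
  qed
  have hom_A: "bounded_operator smul (\<Sum>k=1..n. A k)"
    using hom_sum[of "\<lambda>_. 1"] by simp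
  have "C = (\<Sum>k=1..n. (w k - power_sum (real m - 1) n / real n) *\<^sub>R A k)"
    by (simp add: C_def mellin_transform_def w_def scaleR_left_diff_distrib sum_subtractf
        scaleR_sum_right)
  then have hom_C: "bounded_operator smul C"
    using hom_sum by simp
  have w_sum: "power_sum (real m - 1) n = (\<Sum>k=1..n. w k)"
    by (simp add: power_sum_def w_def)
  have w2: "power_sum (2 * real m - 2) n = (\<Sum>k=1..n. (w k)\<^sup>2)"
    unfolding power_sum_def w_def
    by (intro sum.cong refl) (simp add: power2_eq_square powr_add[symmetric])
  have C_sa: "self_adjoint ip (op_square (op_abs ip C))"
    by (rule self_adjoint_square_abs[OF hom_C])
  have W_sa: "self_adjoint ip (V *\<^sub>R W)"
    unfolding W_def
    by (intro self_adjoint_scaleR self_adjoint_diff self_adjoint_sum self_adjoint_square_abs A hom_A)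
  have "0 \<le> rip ((V *\<^sub>R W - op_square (op_abs ip C)) x) x" for x
  proof -
    have "C x = (\<Sum>k=1..n. w k *\<^sub>R A k x) - (\<Sum>k=1..n. w k) *\<^sub>R ((1 / real n) *\<^sub>R (\<Sum>k=1..n. A k x))"
      unfolding C_def mellin_transform_def w_sum
      by (simp add: blinfun.diff_left blinfun.scaleR_left blinfun.sum_left w_def)
    moreover have "rip (W x) x
        = (1 / real n) * (\<Sum>k=1..n. (norm (A k x))\<^sup>2) - (1 / (real n)\<^sup>2) * (norm (\<Sum>k=1..n. A k x))\<^sup>2"
      by (simp add: W_def blinfun.diff_left blinfun.scaleR_left blinfun.sum_left rip_diff_left
          rip_scaleR_left rip_sum_left rip_square_abs A hom_A del: One_nat_def)
    ultimately have "(norm (C x))\<^sup>2 \<le> V * rip (W x) x"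
      using norm_covariance_square_le[of "{1..n}" w "\<lambda>k. A k x"] assms(3)
      by (simp add: V_def w_sum w2)
    then show ?thesis
      by (simp add: blinfun.diff_left blinfun.scaleR_left rip_diff_left rip_scaleR_left rip_square_abs hom_C)
  qed
  then have "op_le ip (op_square (op_abs ip C)) (V *\<^sub>R W)"
    unfolding op_le_def positive_op_iff using C_sa W_sa self_adjoint_diff by blast
  then show ?thesis
    unfolding C_def V_def W_def .
qed

end
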